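(* Let $X$ be a positive random variable with finite $\mathsf{E}X$ and $\mathsf{E}\ln X$, and put $A_X:=\mathsf{E}X$ and $G_X:=\exp\mathsf{E}\ln X$. Suppose that $\mathsf{P}(X=c)<1$ for each real $c$, so that $$\mu:=\frac{A_X}{G_X}>1.$$ Then the following hold. (I) One has $$\mathsf{P}\Big(\frac{X}{G_X}\ge v\Big)\le p_v:=\frac{\mu-z_v}{v-z_v}\in(0,1)\quad\text{for each } v\in(\mu,\infty)$$ and $$\mathsf{P}\Big(\frac{X}{G_X}\le v\Big)\le p_v\in(0,1)\quad\text{for each } v\in(0,1)$$ (with $p_v$ given by the same formula $p_v:=\frac{\mu-z_v}{v-z_v}$), where, for each $v\in(\mu,\infty)$, $z_v$ is the only root $z\in(0,1)$ of the equation $$F(z):=(v-\mu)\ln z+(\mu-z)\ln v=0$$ and, for each $v\in(0,1)$, $z_v$ is the only root $z\in(\mu,\infty)$ of the same equation. (II) For each $v\in(\mu,\infty)$ and for each $v\in(0,1)$, the upper bound $p_v$ in the corresponding inequality in (I) is exact, as it is attained when $$\mathsf{P}(X=v)=p_v=1-\mathsf{P}(X=z_v),$$ and for such a random variable $X$ the condition $A_X/G_X=\mu$ holds. (III) One has $$\sup_{A_X/G_X=\mu}\mathsf{P}\Big(\frac{X}{G_X}\ge v\Big)=1\quad\text{for each } v\in(-\infty,\mu]$$ and $$\sup_{A_X/G_X=\mu}\mathsf{P}\Big(\frac{X}{G_X}\le v\Big)=1\quad\text{for each } v\in[1,\infty),$$ where $\sup_{A_X/G_X=\mu}$ denotes the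 supremum over all positive random variables $X$ with finite $\mathsf{E}X$ and $\mathsf{E}\ln X$ and with $A_X/G_X=\mu$. In particular, for each $v\in[1,\mu]$, the exact upper bound on either one of the two tail probabilities, $\mathsf{P}(X/G_X\ge v)$ and $\mathsf{P}(X/G_X\le v)$, is $1$; it is not attained, though. (IV) One also has the following simple (but not exact) upper bounds on $\mathsf{P}(X/G_X\ge v)$ and $\mathsf{P}(X/G_X\le v)$: $$\mathsf{P}\Big(\frac{X}{G_X}\ge v\Big)\le q_v:=\min\Big(1,\frac{\mu-1}{v-1-\ln v}\Big)\quad\text{for each } v\in[1,\infty)$$ (with $q_1:=1$) and $$\mathsf{P}\Big(\frac{X}{G_X}\le v\Big)\le q_v\quad\text{for each } v\in(0,\mu]$$ (with $q_v$ given by the same formula). (V) The condition $\mu=A_X/G_X$ (in the definition of $\mu$ above) can be replaced by the condition $A_X/G_X\le\mu$.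
   Context: All random variables are real-valued; "positive" means taking values in $(0,\infty)$. $\mathsf{P}$ and $\mathsf{E}$ denote probability and expectation. $A_X$ and $G_X$ are called the arithmetic and geometric means of $X$.
   Formalization: In (V), under A_X/G_X ≤ μ, "it is not attained" for P(X/G_X ≤ v) is claimed only at v=1, not for v in (1,μ], where it is false: a nearly constant non-constant X has P(X/G_X ≤ v)=1. The right-tail remark is kept for all v in [1,μ]. *)

theory Defs
  imports "HOL-Probability.Probability"
begin

definition pos_rv :: "'a measure \<Rightarrow> ('a \<Rightarrow> real) \<Rightarrow> bool" where
  "pos_rv M X \<longleftrightarrow> prob_space M \<and> X \<in> borel_measurable M \<and> (\<forall>\<omega>\<in>space M. 0 < X \<omega>)"

definition admissible :: "'a measure \<Rightarrow> ('a \<Rightarrow> real) \<Rightarrow> bool" where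
  "admissible M X \<longleftrightarrow> pos_rv M X \<and> integrable M X \<and> integrable M (\<lambda>\<omega>. ln (X \<omega>))"

definition nonconstant_rv :: "'a measure \<Rightarrow> ('a \<Rightarrow> real) \<Rightarrow> bool" where
  "nonconstant_rv M X \<longleftrightarrow> (\<forall>c::real. measure M {\<omega> \<in> space M. X \<omega> = c} < 1)"

definition arith_mean :: "'a measure \<Rightarrow> ('a \<Rightarrow> real) \<Rightarrow> real" where
  "arith_mean M X = integral\<^sup>L M X"

definition geom_mean :: "'a measure \<Rightarrow> ('a \<Rightarrow> real) \<Rightarrow> real" where
  "geom_mean M X = exp (integral\<^sup>L M (\<lambda>\<omega>. ln (X \<omega>)))"

definition ratio :: "'a measure \<Rightarrow> ('a \<Rightarrow> real) \<Rightarrow> real" where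
  "ratio M X = arith_mean M X / geom_mean M X"

definition right_tail :: "'a measure \<Rightarrow> ('a \<Rightarrow> real) \<Rightarrow> real \<Rightarrow> real" where
  "right_tail M X v = measure M {\<omega> \<in> space M. X \<omega> / geom_mean M X \<ge> v}"

definition left_tail :: "'a measure \<Rightarrow> ('a \<Rightarrow> real) \<Rightarrow> real \<Rightarrow> real" where
  "left_tail M X v = measure M {\<omega> \<in> space M. X \<omega> / geom_mean M X \<le> v}"

(* Index sets of the suprema over random variables.  Means and tail probabilities depend only on
   the law of the variable, and every law of a positive random variable is the law of one defined
   on a probability space of type "real measure"; so nothing is lost by fixing that type. *)

definition rvs_ratio_eq :: "real \<Rightarrow> (real measure \<times> (real \<Rightarrow> real)) set" where
  "rvs_ratio_eq \<mu> = {(N, Y). admissible N Y \<and> ratio N Y = \<mu>}"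

definition rvs_ratio_le :: "real \<Rightarrow> (real measure \<times> (real \<Rightarrow> real)) set" where
  "rvs_ratio_le \<mu> = {(N, Y). admissible N Y \<and> ratio N Y \<le> \<mu>}"

definition F_eq :: "real \<Rightarrow> real \<Rightarrow> real \<Rightarrow> real" where
  "F_eq \<mu> v z = (v - \<mu>) * ln z + (\<mu> - z) * ln v"

(* Meaningful for v > \<mu> and for 0 < v < 1 only (with \<mu> > 1). *)
definition z_root :: "real \<Rightarrow> real \<Rightarrow> real" where
  "z_root \<mu> v = (if \<mu> < v then (THE z. z \<in> {0<..<1} \<and> F_eq \<mu> v z = 0)
                 else (THE z. z \<in> {\<mu><..} \<and> F_eq \<mu> v z = 0))"

definition p_bound :: "real \<Rightarrow> real \<Rightarrow> real" where
  "p_bound \<mu> v = (\<mu> - z_root \<mu> v) / (v - z_root \<mu> v)"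

definition q_bound :: "real \<Rightarrow> real \<Rightarrow> real" where
  "q_bound \<mu> v = (if v = 1 then 1 else min 1 ((\<mu> - 1) / (v - 1 - ln v)))"

definition two_point :: "'a measure \<Rightarrow> ('a \<Rightarrow> real) \<Rightarrow> real \<Rightarrow> real \<Rightarrow> real \<Rightarrow> bool" where
  "two_point M X a b p \<longleftrightarrow> pos_rv M X
     \<and> measure M {\<omega> \<in> space M. X \<omega> = a} = p
     \<and> p = 1 - measure M {\<omega> \<in> space M. X \<omega> = b}"

end

theory Submission
  imports Defs
begin

text \<open>
  Write \<open>Y = X / G\<^sub>X\<close>, so that \<open>E Y = A\<^sub>X / G\<^sub>X\<close> and \<open>E ln Y = 0\<close>.  The function
  \<open>g y = y - 1 - ln y\<close> is nonnegative, vanishes only at \<open>1\<close>, and is monotone on either side of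
  \<open>1\<close>, while \<open>E g (Y / z) = E Y / z - 1 + ln z\<close> for every \<open>z > 0\<close>.  Hence Markov's inequality
  for \<open>g (Y / z)\<close> bounds a tail at \<open>v\<close> by \<open>(E Y / z - 1 + ln z) / g (v / z)\<close>, which is increasing
  in \<open>E Y\<close>.  For \<open>z = 1\<close> this is \<open>q\<^sub>v\<close>.  For \<open>z = z\<^sub>v\<close> it is \<open>p\<^sub>v\<close>, because \<open>F z\<^sub>v = 0\<close> says exactly
  that the law with mass \<open>p\<^sub>v\<close> at \<open>v\<close> and \<open>1 - p\<^sub>v\<close> at \<open>z\<^sub>v\<close> has mean \<open>\<mu>\<close> and geometric mean \<open>1\<close>;
  this law gives equality.  The suprema in (III) are \<open>1\<close> since \<open>p\<^sub>v\<close> tends to \<open>1\<close> as \<open>v\<close> decreases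
  to \<open>\<mu>\<close> or increases to \<open>1\<close>.
\<close>

section \<open>Sign and monotonicity of the logarithmic gap\<close>

definition log_gap :: "real \<Rightarrow> real" where
  "log_gap y = y - 1 - ln y"

lemma log_gap_nonneg: "0 < y \<Longrightarrow> 0 \<le> log_gap y"
  using ln_le_minus_one[of y] by (simp add: log_gap_def)

lemma log_gap_eq_0_iff: "0 < y \<Longrightarrow> log_gap y = 0 \<longleftrightarrow> y = 1"
  using ln_eq_minus_one[of y] by (auto simp: log_gap_def)

lemma log_gap_pos: "0 < y \<Longrightarrow> y \<noteq> 1 \<Longrightarrow> 0 < log_gap y"
  using log_gap_nonneg[of y] log_gap_eq_0_iff[of y] by simp

text \<open>\<open>ln\<close> lies below its tangent at \<open>x\<close>, whose slope is at most 1
  because \<open>1 \<le> x\<close>. In \<open>log_gap_antimono\<close> the tangent is taken at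
  \<open>y \<le> 1\<close>, where the slope is at least 1.\<close>

lemma log_gap_mono:
  assumes "1 \<le> x" "x \<le> y"
  shows "log_gap x \<le> log_gap y"
proof -
  have "ln y - ln x \<le> (y - x) / x"
    using ln_diff_le[of y x] assms by simp
  also have "\<dots> \<le> y - x"
    using assms by (simp add: divide_le_eq mult_le_cancel_left1)
  finally show ?thesis by (simp add: log_gap_def)
qed

lemma log_gap_antimono:
  assumes "0 < x" "x \<le> y" "y \<le> 1"
  shows "log_gap y \<le> log_gap x"
proof -
  have "ln x - ln y \<le> (x - y) / y"
    using ln_diff_le[of x y] assms by simp
  also have "\<dots> \<le> x - y"
  proof -
    have "0 \<le> (y - x) * (1 - y)" using assms by simp
    then have "x - y \<le> (x - y) * y" by (simp add: algebra_simps)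
    then show ?thesis using assms by (simp add: pos_divide_le_eq)
  qed
  finally show ?thesis by (simp add: log_gap_def)
qed

section \<open>Existence and uniqueness of the roots of \<open>F_eq\<close>\<close>

text \<open>By Rolle, three roots would give two zeros of the derivative, which is injective in \<open>z\<close>.\<close>
lemma F_eq_at_most_two_roots:
  assumes "0 < x" "x < y" "y < w" "v \<noteq> \<mu>"
    and "F_eq \<mu> v x = 0" "F_eq \<mu> v y = 0" "F_eq \<mu> v w = 0"
  shows False
proof -
  let ?F' = "\<lambda>z. (v - \<mu>) / z - ln v"
  have deriv: "(F_eq \<mu> v has_real_derivative ?F' z) (at z)" if "0 < z" for z
    unfolding F_eq_def using that by (auto intro!: derivative_eq_intros)
  have rolle: "\<exists>z. a < z \<and> z < b \<and> ?F' z = 0"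
    if "0 < a" "a < b" "F_eq \<mu> v a = 0" "F_eq \<mu> v b = 0" for a b
  proof -
    have "\<exists>z>a. z < b \<and> F_eq \<mu> v b - F_eq \<mu> v a = (b - a) * ?F' z"
      by (rule MVT2) (use deriv that in auto)
    then show ?thesis using that by auto
  qed
  obtain s where s: "x < s" "s < y" "?F' s = 0" using rolle[of x y] assms by auto
  obtain t where t: "y < t" "t < w" "?F' t = 0" using rolle[of y w] assms by auto
  have "(v - \<mu>) / s = (v - \<mu>) / t" using s t by simp
  then have "s = t" using s t assms by (simp add: field_simps)
  then show False using s t by simp
qed

lemma isCont_F_eq: "0 < z \<Longrightarrow> isCont (F_eq \<mu> v) z"
  unfolding F_eq_def by (intro continuous_intros) auto

lemma F_eq_self [simp]: "F_eq \<mu> v v = 0"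
  by (simp add: F_eq_def algebra_simps)

text \<open>Existence comes from a sign change. For uniqueness, \<open>v\<close> is itself a root
  outside the interval, so two roots inside would make three.\<close>

lemma ex1_root_below_1:
  assumes "1 < \<mu>" "\<mu> < v"
  shows "\<exists>!z. z \<in> {0<..<1} \<and> F_eq \<mu> v z = 0"
proof (rule ex_ex1I)
  have ln_v: "0 < ln v" using assms by simp
  \<comment> \<open>\<open>a\<close> solves \<open>(v - \<mu>) * ln a = - \<mu> * ln v\<close>, so
    only the negative term \<open>- a * ln v\<close> of \<open>F_eq\<close> survives.\<close>
  define a where "a = exp (- (\<mu> * ln v / (v - \<mu>)))"
  have a: "0 < a" "a < 1" using assms ln_v by (auto simp: a_def)
  have "(v - \<mu>) * ln a = - (\<mu> * ln v)" using assms by (simp add: a_def)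
  then have "F_eq \<mu> v a = - a * ln v" by (simp add: F_eq_def algebra_simps)
  then have neg: "F_eq \<mu> v a < 0" using a ln_v by simp
  have pos: "0 < F_eq \<mu> v 1" using assms ln_v by (simp add: F_eq_def)
  obtain z where z: "a \<le> z" "z \<le> 1" "F_eq \<mu> v z = 0"
    using IVT[of "F_eq \<mu> v" a 0 1] neg pos a isCont_F_eq by force
  then have "z \<noteq> 1" using pos by auto
  then show "\<exists>z. z \<in> {0<..<1} \<and> F_eq \<mu> v z = 0" using z a by (intro exI[of _ z]) auto
next
  fix y z assume *: "y \<in> {0<..<1} \<and> F_eq \<mu> v y = 0" "z \<in> {0<..<1} \<and> F_eq \<mu> v z = 0"
  show "y = z"
    using F_eq_at_most_two_roots[of y z v v \<mu>] F_eq_at_most_two_roots[of z y v v \<mu>] * assms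
    by (cases y z rule: linorder_cases) auto
qed

text \<open>Again \<open>v\<close> is the extra root, now below the interval. \<open>F_eq\<close> is
  negative at \<mu>; a point \<open>b\<close> with positive value must be constructed, since the
  interval is unbounded.\<close>

lemma ex1_root_above:
  assumes "1 < \<mu>" "0 < v" "v < 1"
  shows "\<exists>!z. z \<in> {\<mu><..} \<and> F_eq \<mu> v z = 0"
proof (rule ex_ex1I)
  define L where "L = - ln v"
  have L: "0 < L" using assms by (simp add: L_def)
  \<comment> \<open>\<open>ln z \<le> z / c - 1 + ln c\<close> for this \<open>c\<close> makes the linear term of \<open>F_eq\<close> dominate\<close>
  define c where "c = 2 * (\<mu> - v) / L"
  have c: "0 < c" using L assms by (simp add: c_def)
  \<comment> \<open>Half of the linear term \<open>L * b\<close> absorbs the logarithm through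
    \<open>c\<close>; the other half must exceed the constant
    \<open>\<mu> * L + (\<mu> - v) * ln c\<close>, which the last summand achieves. The summand
    \<open>\<mu> + 1\<close> gives \<open>\<mu> < b\<close> and strictness.\<close>
  define b where "b = \<mu> + 1 + 2 * \<bar>\<mu> * L + (\<mu> - v) * ln c\<bar> / L"
  have b: "\<mu> < b" using L by (simp add: b_def add_pos_nonneg)
  have "0 < b" using b assms by simp
  then have ln_bc: "ln (b / c) = ln b - ln c" using c by (simp add: ln_div)
  have bc: "(\<mu> - v) * (b / c) = L * b / 2"
    using L assms by (simp add: c_def field_simps)
  have "(\<mu> - v) * (b / c - ln (b / c)) = L * b / 2 - (\<mu> - v) * (ln b - ln c)"
    by (subst right_diff_distrib) (simp only: bc ln_bc)
  moreover have "ln v = - L" by (simp add: L_def)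
  ultimately have "F_eq \<mu> v b = L * b / 2 - (\<mu> * L + (\<mu> - v) * ln c) + (\<mu> - v) * (b / c - ln (b / c))"
    unfolding F_eq_def by (simp add: algebra_simps)
  moreover have "\<mu> * L + (\<mu> - v) * ln c < L * b / 2"
  proof -
    have "L * b / 2 = L * (\<mu> + 1) / 2 + \<bar>\<mu> * L + (\<mu> - v) * ln c\<bar>"
      using L by (simp add: b_def distrib_left add_divide_distrib)
    moreover have "0 < L * (\<mu> + 1)" using L assms by simp
    ultimately show ?thesis by linarith
  qed
  moreover have "0 \<le> (\<mu> - v) * (b / c - ln (b / c))"
    using log_gap_nonneg[of "b / c"] b c assms by (auto simp: log_gap_def intro!: mult_nonneg_nonneg)
  ultimately have Fb: "0 < F_eq \<mu> v b" by linarith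
  have neg: "F_eq \<mu> v \<mu> < 0"
    using assms by (simp add: F_eq_def mult_less_0_iff)
  obtain z where z: "\<mu> \<le> z" "z \<le> b" "F_eq \<mu> v z = 0"
    using IVT[of "F_eq \<mu> v" \<mu> 0 b] neg b Fb assms isCont_F_eq by force
  then have "z \<noteq> \<mu>" using neg by auto
  then show "\<exists>z. z \<in> {\<mu><..} \<and> F_eq \<mu> v z = 0" using z by (intro exI[of _ z]) auto
next
  fix y z assume *: "y \<in> {\<mu><..} \<and> F_eq \<mu> v y = 0" "z \<in> {\<mu><..} \<and> F_eq \<mu> v z = 0"
  show "y = z"
    using F_eq_at_most_two_roots[of v y z v \<mu>] F_eq_at_most_two_roots[of v z y v \<mu>] * assms
    by (cases y z rule: linorder_cases) auto
qed

section \<open>The parameters of the extremal two-point law\<close>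

lemma z_root_below_1:
  assumes "1 < \<mu>" "\<mu> < v"
  shows "0 < z_root \<mu> v" "z_root \<mu> v < 1" "F_eq \<mu> v (z_root \<mu> v) = 0"
  using theI'[OF ex1_root_below_1[OF assms]] assms by (simp_all add: z_root_def)

lemma z_root_above:
  assumes "1 < \<mu>" "0 < v" "v < 1"
  shows "\<mu> < z_root \<mu> v" "F_eq \<mu> v (z_root \<mu> v) = 0"
  using theI'[OF ex1_root_above[OF assms]] assms by (simp_all add: z_root_def)

text \<open>In both ranges \<mu> lies strictly between \<open>z_root \<mu> v\<close> and
  \<open>v\<close>, and \<open>p_bound\<close> is its relative position on that segment.\<close>

lemma p_bound_in_unit:
  assumes "1 < \<mu>" "v \<in> {0<..<1} \<union> {\<mu><..}"
  shows "p_bound \<mu> v \<in> {0<..<1}"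
  using assms z_root_below_1[of \<mu> v] z_root_above[of \<mu> v]
  by (auto simp: p_bound_def divide_simps)

lemma z_root_props:
  assumes "1 < \<mu>" "v \<in> {0<..<1} \<union> {\<mu><..}"
  shows "0 < v" "0 < z_root \<mu> v" "z_root \<mu> v \<noteq> v" "z_root \<mu> v \<noteq> 1"
    "F_eq \<mu> v (z_root \<mu> v) = 0"
  using assms z_root_below_1[of \<mu> v] z_root_above[of \<mu> v] by auto

lemma p_bound_moments:
  assumes "1 < \<mu>" "v \<in> {0<..<1} \<union> {\<mu><..}"
  defines "p \<equiv> p_bound \<mu> v" and "z \<equiv> z_root \<mu> v"
  shows "p * v + (1 - p) * z = \<mu>" "p * ln v + (1 - p) * ln z = 0"
proof -
  note z = z_root_props[OF assms(1,2), folded z_def]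
  have p: "p * (v - z) = \<mu> - z" using z by (simp add: p_def p_bound_def z_def)
  then show "p * v + (1 - p) * z = \<mu>" by (simp add: algebra_simps)
  \<comment> \<open>Multiplying the logarithmic moment by \<open>v - z\<close>, which is nonzero,
    clears the denominator of \<open>p\<close> and leaves exactly \<open>F_eq\<close>.\<close>
  have "(v - z) * (p * ln v + (1 - p) * ln z)
      = p * (v - z) * ln v + (v - z - p * (v - z)) * ln z"
    by (simp add: algebra_simps)
  also have "\<dots> = F_eq \<mu> v z" unfolding p by (simp add: F_eq_def)
  finally show "p * ln v + (1 - p) * ln z = 0" using z by simp
qed

text \<open>Under the two-point law the gap has mean \<open>\<mu> - 1\<close>. The simple bound
  discards the contribution of the atom \<open>z\<close>, which is positive since
  \<open>z \<noteq> 1\<close>; hence \<open>q_bound\<close> is not exact.\<close>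

lemma p_bound_less_q_bound:
  assumes "1 < \<mu>" "v \<in> {0<..<1} \<union> {\<mu><..}"
  shows "p_bound \<mu> v < q_bound \<mu> v"
proof -
  define p where "p = p_bound \<mu> v"
  define z where "z = z_root \<mu> v"
  note z = z_root_props[OF assms(1,2), folded z_def]
  note m = p_bound_moments[OF assms(1,2), folded p_def z_def]
  have p: "0 < p" "p < 1" using p_bound_in_unit[OF assms] by (auto simp: p_def)
  have v: "v \<noteq> 1" using assms by auto
  have gv: "0 < log_gap v" and gz: "0 < log_gap z" using log_gap_pos z v by auto
  have "p * log_gap v + (1 - p) * log_gap z
      = (p * v + (1 - p) * z) - 1 - (p * ln v + (1 - p) * ln z)"
    by (simp add: log_gap_def algebra_simps)
  then have "p * log_gap v + (1 - p) * log_gap z = \<mu> - 1" using m by simp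
  moreover have "0 < (1 - p) * log_gap z" using p gz by simp
  ultimately have "p * log_gap v < \<mu> - 1" by linarith
  then have "p < (\<mu> - 1) / log_gap v" using gv by (simp add: less_divide_eq)
  then show ?thesis using p v by (simp add: q_bound_def p_def log_gap_def)
qed

section \<open>Moments of the normalized variable and Markov's inequality\<close>

lemma admissibleD:
  assumes "admissible M X"
  shows "prob_space M" "X \<in> borel_measurable M" "\<And>\<omega>. \<omega> \<in> space M \<Longrightarrow> 0 < X \<omega>"
    "integrable M X" "integrable M (\<lambda>\<omega>. ln (X \<omega>))"
  using assms by (auto simp: admissible_def pos_rv_def)

lemma geom_mean_pos [simp]: "0 < geom_mean M X"
  by (simp add: geom_mean_def)

lemma ln_normalized:
  assumes "admissible M X" "\<omega> \<in> space M"
  shows "ln (X \<omega> / geom_mean M X) = ln (X \<omega>) - integral\<^sup>L M (\<lambda>\<omega>. ln (X \<omega>))"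
  using admissibleD(3)[OF assms] by (simp add: ln_div geom_mean_def)

lemma normalized_moments:
  assumes adm: "admissible M X"
  defines "Y \<equiv> \<lambda>\<omega>. X \<omega> / geom_mean M X"
  shows "has_bochner_integral M Y (ratio M X)"
    and "has_bochner_integral M (\<lambda>\<omega>. ln (Y \<omega>)) 0"
proof -
  interpret prob_space M by (rule admissibleD(1)[OF adm])
  have [simp]: "integrable M X" "integrable M (\<lambda>\<omega>. ln (X \<omega>))"
    using admissibleD[OF adm] by auto
  show "has_bochner_integral M Y (ratio M X)"
    unfolding Y_def has_bochner_integral_iff by (simp add: ratio_def arith_mean_def)
  have "has_bochner_integral M (\<lambda>\<omega>. ln (X \<omega>) - integral\<^sup>L M (\<lambda>\<omega>. ln (X \<omega>))) 0"
    unfolding has_bochner_integral_iff by (simp add: prob_space)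
  then show "has_bochner_integral M (\<lambda>\<omega>. ln (Y \<omega>)) 0"
    unfolding Y_def
    by (subst has_bochner_integral_cong[OF refl ln_normalized[OF adm] refl])
qed

lemma log_gap_moment:
  assumes adm: "admissible M X" and z: "0 < z"
  shows "has_bochner_integral M (\<lambda>\<omega>. log_gap (X \<omega> / geom_mean M X / z)) (ratio M X / z - 1 + ln z)"
proof -
  interpret prob_space M by (rule admissibleD(1)[OF adm])
  let ?Y = "\<lambda>\<omega>. X \<omega> / geom_mean M X"
  have "has_bochner_integral M (\<lambda>_. ln z - 1) (ln z - 1)"
    unfolding has_bochner_integral_iff by (simp add: prob_space)
  from has_bochner_integral_add[OF has_bochner_integral_diff[OF
      has_bochner_integral_divide_zero[OF normalized_moments(1)[OF adm], of z]
      normalized_moments(2)[OF adm]] this]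
  have *: "has_bochner_integral M (\<lambda>\<omega>. ?Y \<omega> / z - ln (?Y \<omega>) + (ln z - 1)) (ratio M X / z - 1 + ln z)"
    by (simp add: algebra_simps)
  have "log_gap (?Y \<omega> / z) = ?Y \<omega> / z - ln (?Y \<omega>) + (ln z - 1)" if "\<omega> \<in> space M" for \<omega>
    using admissibleD(3)[OF adm that] z ln_div[of "?Y \<omega>" z] geom_mean_pos[of M X]
    by (simp add: log_gap_def less_imp_neq)
  then show ?thesis
    by (subst has_bochner_integral_cong[OF refl _ refl]) (use * in auto)
qed

text \<open>The predicate \<open>P\<close> stands for either tail. The gap dominates
  \<open>g\<close> on the event and is nonnegative off it, so integrating this pointwise comparison
  suffices.\<close>

lemma log_gap_Markov:
  assumes adm: "admissible M X" and z: "0 < z" and g: "0 < g"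
    and meas: "{\<omega> \<in> space M. P (X \<omega> / geom_mean M X)} \<in> sets M"
    and P: "\<And>y. 0 < y \<Longrightarrow> P y \<Longrightarrow> g \<le> log_gap (y / z)"
  shows "measure M {\<omega> \<in> space M. P (X \<omega> / geom_mean M X)} \<le> (ratio M X / z - 1 + ln z) / g"
proof -
  interpret prob_space M by (rule admissibleD(1)[OF adm])
  let ?Y = "\<lambda>\<omega>. X \<omega> / geom_mean M X"
  let ?A = "{\<omega> \<in> space M. P (?Y \<omega>)}"
  let ?h = "\<lambda>\<omega>. log_gap (?Y \<omega> / z)"
  have h: "integrable M ?h" "integral\<^sup>L M ?h = ratio M X / z - 1 + ln z"
    using log_gap_moment[OF adm z] by (auto simp: has_bochner_integral_iff)
  have pos: "0 < ?Y \<omega>" if "\<omega> \<in> space M" for \<omega> using admissibleD(3)[OF adm that] by simp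
  have "g * measure M ?A = integral\<^sup>L M (\<lambda>\<omega>. g * indicator ?A \<omega>)" using meas by simp
  also have "\<dots> \<le> integral\<^sup>L M ?h"
  proof (rule integral_mono)
    show "integrable M (\<lambda>\<omega>. g * indicator ?A \<omega>)" using meas by (simp add: emeasure_eq_measure)
    fix \<omega> assume "\<omega> \<in> space M"
    then show "g * indicator ?A \<omega> \<le> ?h \<omega>"
      using P[OF pos[of \<omega>]] log_gap_nonneg[OF divide_pos_pos[OF pos[of \<omega>] z]]
      by (auto simp: indicator_def)
  qed (rule h)
  finally show ?thesis using g h by (simp add: le_divide_eq mult.commute)
qed

lemma tail_measurable:
  assumes "admissible M X"
  shows "{\<omega> \<in> space M. v \<le> X \<omega> / geom_mean M X} \<in> sets M"
    "{\<omega> \<in> space M. X \<omega> / geom_mean M X \<le> v} \<in> sets M"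
  using admissibleD(2)[OF assms] by measurable

lemma tail_le_1:
  assumes "admissible M X"
  shows "right_tail M X v \<le> 1" "left_tail M X v \<le> 1"
proof -
  interpret prob_space M by (rule admissibleD(1)[OF assms])
  show "right_tail M X v \<le> 1" "left_tail M X v \<le> 1"
    by (simp_all add: right_tail_def left_tail_def)
qed

section \<open>Upper bounds on the tails\<close>

text \<open>Markov's bound is tight for the two-point law: the gap of \<open>y / z\<close> vanishes
  at the atom \<open>y = z\<close>, so its mean is the mass at \<open>v\<close> times its value
  there.\<close>

lemma p_bound_eq_log_gap:
  assumes "1 < \<mu>" "v \<in> {0<..<1} \<union> {\<mu><..}"
  defines "z \<equiv> z_root \<mu> v"
  shows "(\<mu> / z - 1 + ln z) / log_gap (v / z) = p_bound \<mu> v"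
proof -
  define p where "p = p_bound \<mu> v"
  note z = z_root_props[OF assms(1,2), folded z_def]
  note m = p_bound_moments[OF assms(1,2), folded p_def z_def]
  have g: "0 < log_gap (v / z)" using log_gap_pos[of "v / z"] z by auto
  have "p * log_gap (v / z) = (p * v + (1 - p) * z) / z - 1 + ln z - (p * ln v + (1 - p) * ln z)"
    using z by (simp add: log_gap_def ln_div field_simps)
  then have "p * log_gap (v / z) = \<mu> / z - 1 + ln z" using m by simp
  then show ?thesis using g by (simp add: p_def divide_eq_eq)
qed

lemma right_tail_le_p_bound:
  assumes adm: "admissible M X" and r: "ratio M X \<le> \<mu>" and v: "1 < \<mu>" "\<mu> < v"
  shows "right_tail M X v \<le> p_bound \<mu> v"
proof -
  define z where "z = z_root \<mu> v"
  note z = z_root_below_1[OF v, folded z_def]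
  have g: "0 < log_gap (v / z)" using log_gap_pos[of "v / z"] z v by auto
  have "right_tail M X v \<le> (ratio M X / z - 1 + ln z) / log_gap (v / z)"
    unfolding right_tail_def
    by (rule log_gap_Markov[OF adm z(1) g])
       (use z v tail_measurable[OF adm] in \<open>auto intro!: log_gap_mono divide_right_mono\<close>)
  \<comment> \<open>\<open>z\<close> depends on \<mu> only, so a ratio below \<mu> just lowers the
    numerator.\<close>
  also have "\<dots> \<le> (\<mu> / z - 1 + ln z) / log_gap (v / z)"
    using r z g by (intro divide_right_mono add_right_mono diff_right_mono) auto
  also have "\<dots> = p_bound \<mu> v" unfolding z_def by (rule p_bound_eq_log_gap) (use v in auto)
  finally show ?thesis .
qed

text \<open>Here \<open>v < 1 < \<mu> < z\<close>, so the tail is carried to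
  \<open>y / z \<le> v / z < 1\<close>, on the decreasing branch of the gap.\<close>

lemma left_tail_le_p_bound:
  assumes adm: "admissible M X" and r: "ratio M X \<le> \<mu>" and v: "1 < \<mu>" "0 < v" "v < 1"
  shows "left_tail M X v \<le> p_bound \<mu> v"
proof -
  define z where "z = z_root \<mu> v"
  note z' = z_root_above[OF v, folded z_def]
  have z: "0 < z" using z' v by simp
  have g: "0 < log_gap (v / z)" using log_gap_pos[of "v / z"] z z' v by auto
  have "left_tail M X v \<le> (ratio M X / z - 1 + ln z) / log_gap (v / z)"
    unfolding left_tail_def
    by (rule log_gap_Markov[OF adm z g])
       (use z z' v tail_measurable[OF adm] in \<open>auto intro!: log_gap_antimono divide_right_mono\<close>)
  also have "\<dots> \<le> (\<mu> / z - 1 + ln z) / log_gap (v / z)"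
    using r z g by (intro divide_right_mono add_right_mono diff_right_mono) auto
  also have "\<dots> = p_bound \<mu> v" unfolding z_def by (rule p_bound_eq_log_gap) (use v in auto)
  finally show ?thesis .
qed

lemma right_tail_le_q_bound:
  assumes adm: "admissible M X" and r: "ratio M X \<le> \<mu>" and v: "1 \<le> v"
  shows "right_tail M X v \<le> q_bound \<mu> v"
proof (cases "v = 1")
  case True
  then show ?thesis using tail_le_1[OF adm] by (simp add: q_bound_def)
next
  case False
  then have g: "0 < log_gap v" using log_gap_pos[of v] v by auto
  have "right_tail M X v \<le> (ratio M X / 1 - 1 + ln 1) / log_gap v"
    unfolding right_tail_def
    by (rule log_gap_Markov[OF adm _ g])
       (use v tail_measurable[OF adm] in \<open>auto intro!: log_gap_mono\<close>)
  also have "\<dots> \<le> (\<mu> - 1) / log_gap v" using r g by (simp add: divide_right_mono)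
  finally show ?thesis using tail_le_1[OF adm] False by (simp add: q_bound_def log_gap_def)
qed

lemma left_tail_le_q_bound:
  assumes adm: "admissible M X" and r: "ratio M X \<le> \<mu>" and v: "0 < v" "v \<le> \<mu>"
  shows "left_tail M X v \<le> q_bound \<mu> v"
proof (cases v "1::real" rule: linorder_cases)
  case equal
  then show ?thesis using tail_le_1[OF adm] by (simp add: q_bound_def)
next
  case less
  then have g: "0 < log_gap v" using log_gap_pos[of v] v by auto
  have "left_tail M X v \<le> (ratio M X / 1 - 1 + ln 1) / log_gap v"
    unfolding left_tail_def
    by (rule log_gap_Markov[OF adm _ g])
       (use v less tail_measurable[OF adm] in \<open>auto intro!: log_gap_antimono\<close>)
  also have "\<dots> \<le> (\<mu> - 1) / log_gap v" using r g by (simp add: divide_right_mono)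
  finally show ?thesis using tail_le_1[OF adm] less by (simp add: q_bound_def log_gap_def)
next
  \<comment> \<open>Above 1 the left tail contains the zero of the gap, so Markov gives nothing; but
    the quotient in \<open>q_bound\<close> is then at least 1 and the bound is trivial.\<close>
  case greater
  have "0 < log_gap v" using log_gap_pos[of v] greater by auto
  moreover have "log_gap v \<le> \<mu> - 1" using greater v ln_gt_zero[OF greater] unfolding log_gap_def by linarith
  ultimately have "1 \<le> (\<mu> - 1) / log_gap v" by (simp add: le_divide_eq)
  then show ?thesis using tail_le_1[OF adm] greater by (simp add: q_bound_def log_gap_def)
qed

section \<open>Equality cases and strictness\<close>

text \<open>The mean of the logarithm is both \<open>ln c\<close> and 0, which forces
  \<open>c = 1\<close>; \<open>X\<close> itself is then almost surely constant.\<close>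

lemma normalized_constant:
  assumes adm: "admissible M X" and const: "AE \<omega> in M. X \<omega> / geom_mean M X = c"
  shows "ratio M X = 1" "\<not> nonconstant_rv M X"
proof -
  interpret prob_space M by (rule admissibleD(1)[OF adm])
  have [measurable]: "X \<in> borel_measurable M" by (rule admissibleD(2)[OF adm])
  let ?Y = "\<lambda>\<omega>. X \<omega> / geom_mean M X"
  \<comment> \<open>Positivity of \<open>c\<close> is what lets \<open>ln c = 0\<close> yield
    \<open>c = 1\<close>.\<close>
  have "AE \<omega> in M. 0 < c"
    using const AE_space
  proof eventually_elim
    case (elim \<omega>)
    then show ?case using admissibleD(3)[OF adm, of \<omega>] by (metis divide_pos_pos geom_mean_pos)
  qed
  then have c: "0 < c" by simp
  have "ratio M X = integral\<^sup>L M ?Y"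
    using normalized_moments(1)[OF adm] by (simp add: has_bochner_integral_iff)
  also have "\<dots> = integral\<^sup>L M (\<lambda>_. c)" by (rule integral_cong_AE) (use const in auto)
  finally have r: "ratio M X = c" by (simp add: prob_space)
  have "0 = integral\<^sup>L M (\<lambda>\<omega>. ln (?Y \<omega>))"
    using normalized_moments(2)[OF adm] by (simp add: has_bochner_integral_iff)
  also have "\<dots> = integral\<^sup>L M (\<lambda>_. ln c)" by (rule integral_cong_AE) (use const in auto)
  finally have "ln c = 0" by (simp add: prob_space)
  then show "ratio M X = 1" using r c by simp
  have "AE \<omega> in M. X \<omega> = c * geom_mean M X"
    using const by eventually_elim (use geom_mean_pos[of M X] in \<open>auto simp: field_simps\<close>)
  then have "measure M {\<omega> \<in> space M. X \<omega> = c * geom_mean M X} = 1"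
    by (subst prob_Collect_eq_1) auto
  then show "\<not> nonconstant_rv M X"
    unfolding nonconstant_rv_def by (metis less_irrefl)
qed

text \<open>Jensen's inequality in the form that the nonnegative gap at \<open>z = 1\<close> has
  mean \<open>ratio M X - 1\<close>.\<close>

lemma ratio_ge_1:
  assumes adm: "admissible M X"
  shows "1 \<le> ratio M X"
proof -
  have "0 \<le> integral\<^sup>L M (\<lambda>\<omega>. log_gap (X \<omega> / geom_mean M X / 1))"
    by (rule Bochner_Integration.integral_nonneg) (use admissibleD(3)[OF adm] in \<open>auto intro!: log_gap_nonneg\<close>)
  also have "\<dots> = ratio M X - 1"
    using log_gap_moment[OF adm, of 1] by (simp add: has_bochner_integral_iff)
  finally show ?thesis by simp
qed

text \<open>With ratio 1 the nonnegative gap has mean 0, so it vanishes almost surely, and 1 is its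
  only zero.\<close>

lemma ratio_gt_1:
  assumes adm: "admissible M X" and "nonconstant_rv M X"
  shows "1 < ratio M X"
proof (rule ccontr)
  assume "\<not> 1 < ratio M X"
  then have r: "ratio M X = 1" using ratio_ge_1[OF adm] by simp
  let ?h = "\<lambda>\<omega>. log_gap (X \<omega> / geom_mean M X)"
  have pos: "0 < X \<omega> / geom_mean M X" if "\<omega> \<in> space M" for \<omega>
    using admissibleD(3)[OF adm that] by simp
  have "integrable M ?h" "integral\<^sup>L M ?h = 0"
    using log_gap_moment[OF adm, of 1] r by (auto simp: has_bochner_integral_iff)
  then have "AE \<omega> in M. ?h \<omega> = 0"
    using integral_nonneg_eq_0_iff_AE[of M ?h] pos log_gap_nonneg by auto
  with AE_space have "AE \<omega> in M. X \<omega> / geom_mean M X = 1"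
    by eventually_elim (use log_gap_eq_0_iff pos in blast)
  from normalized_constant(2)[OF adm this] show False using assms by simp
qed

text \<open>The logarithm of the normalized variable would be almost surely nonnegative with mean 0,
  hence zero.\<close>

lemma right_tail_eq_1_imp:
  assumes adm: "admissible M X" and "right_tail M X v = 1" and v: "1 \<le> v"
  shows "ratio M X = 1" "\<not> nonconstant_rv M X"
proof -
  interpret prob_space M by (rule admissibleD(1)[OF adm])
  have [measurable]: "X \<in> borel_measurable M" by (rule admissibleD(2)[OF adm])
  let ?h = "\<lambda>\<omega>. ln (X \<omega> / geom_mean M X)"
  have tail: "AE \<omega> in M. v \<le> X \<omega> / geom_mean M X"
    using assms(2) unfolding right_tail_def by (subst (asm) prob_Collect_eq_1) auto
  have "integrable M ?h" "integral\<^sup>L M ?h = 0"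
    using normalized_moments(2)[OF adm] by (auto simp: has_bochner_integral_iff)
  moreover have "AE \<omega> in M. 0 \<le> ?h \<omega>"
    using tail by eventually_elim (rule ln_ge_zero, use v in linarith)
  ultimately have "AE \<omega> in M. ?h \<omega> = 0"
    using integral_nonneg_eq_0_iff_AE[of M ?h] by auto
  with tail have "AE \<omega> in M. X \<omega> / geom_mean M X = 1"
    by eventually_elim (use v in \<open>metis ln_eq_zero_iff less_le_trans zero_less_one\<close>)
  from normalized_constant[OF adm this] show "ratio M X = 1" "\<not> nonconstant_rv M X" .
qed

text \<open>The normalized variable would almost surely not exceed its own mean, hence would equal
  it.\<close>

lemma left_tail_eq_1_imp:
  assumes adm: "admissible M X" and "left_tail M X v = 1" and v: "v \<le> ratio M X"
  shows "ratio M X = 1" "\<not> nonconstant_rv M X"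
proof -
  interpret prob_space M by (rule admissibleD(1)[OF adm])
  have [measurable]: "X \<in> borel_measurable M" by (rule admissibleD(2)[OF adm])
  let ?h = "\<lambda>\<omega>. ratio M X - X \<omega> / geom_mean M X"
  have tail: "AE \<omega> in M. X \<omega> / geom_mean M X \<le> v"
    using assms(2) unfolding left_tail_def by (subst (asm) prob_Collect_eq_1) auto
  have "integrable M ?h" "integral\<^sup>L M ?h = 0"
    using normalized_moments(1)[OF adm] by (auto simp: has_bochner_integral_iff prob_space)
  moreover have "AE \<omega> in M. 0 \<le> ?h \<omega>"
    using tail by eventually_elim (use v in linarith)
  ultimately have "AE \<omega> in M. ?h \<omega> = 0"
    using integral_nonneg_eq_0_iff_AE[of M ?h] by auto
  then have "AE \<omega> in M. X \<omega> / geom_mean M X = ratio M X" by eventually_elim simp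
  from normalized_constant[OF adm this] show "ratio M X = 1" "\<not> nonconstant_rv M X" .
qed

section \<open>Two-point laws and attainment\<close>

lemma two_pointD:
  assumes "two_point N Y a b p"
  shows "prob_space N" "Y \<in> borel_measurable N" "\<And>\<omega>. \<omega> \<in> space N \<Longrightarrow> 0 < Y \<omega>"
    "measure N {\<omega> \<in> space N. Y \<omega> = a} = p" "measure N {\<omega> \<in> space N. Y \<omega> = b} = 1 - p"
  using assms by (auto simp: two_point_def pos_rv_def)

lemma two_point_AE:
  assumes tp: "two_point N Y a b p" and ab: "a \<noteq> b"
  shows "AE \<omega> in N. Y \<omega> = a \<or> Y \<omega> = b"
proof -
  interpret prob_space N by (rule two_pointD(1)[OF tp])
  have [measurable]: "Y \<in> borel_measurable N" by (rule two_pointD(2)[OF tp])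
  have "measure N ({\<omega> \<in> space N. Y \<omega> = a} \<union> {\<omega> \<in> space N. Y \<omega> = b})
      = measure N {\<omega> \<in> space N. Y \<omega> = a} + measure N {\<omega> \<in> space N. Y \<omega> = b}"
    using ab by (intro finite_measure_Union) auto
  also have "\<dots> = 1" using two_pointD(4,5)[OF tp] by simp
  also have "{\<omega> \<in> space N. Y \<omega> = a} \<union> {\<omega> \<in> space N. Y \<omega> = b} = {\<omega> \<in> space N. Y \<omega> = a \<or> Y \<omega> = b}"
    by auto
  finally show ?thesis by (subst (asm) prob_Collect_eq_1) auto
qed

lemma two_point_moment:
  fixes h :: "real \<Rightarrow> real"
  assumes tp: "two_point N Y a b p" and ab: "a \<noteq> b" and h[measurable]: "h \<in> borel_measurable borel"
  shows "has_bochner_integral N (\<lambda>\<omega>. h (Y \<omega>)) (p * h a + (1 - p) * h b)"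
proof -
  interpret prob_space N by (rule two_pointD(1)[OF tp])
  have [measurable]: "Y \<in> borel_measurable N" by (rule two_pointD(2)[OF tp])
  let ?A = "\<lambda>c. {\<omega> \<in> space N. Y \<omega> = c}"
  have ind: "has_bochner_integral N (\<lambda>\<omega>. indicator (?A c) \<omega> * h c) (measure N (?A c) * h c)" for c
    by (intro has_bochner_integral_mult_left has_bochner_integral_real_indicator)
       (auto simp: emeasure_eq_measure)
  have "has_bochner_integral N (\<lambda>\<omega>. indicator (?A a) \<omega> * h a + indicator (?A b) \<omega> * h b)
      (p * h a + (1 - p) * h b)"
    using has_bochner_integral_add[OF ind[of a] ind[of b]] two_pointD(4,5)[OF tp] by simp
  moreover have "AE \<omega> in N. indicator (?A a) \<omega> * h a + indicator (?A b) \<omega> * h b = h (Y \<omega>)"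
    using two_point_AE[OF tp ab] AE_space by eventually_elim (use ab in auto)
  ultimately show ?thesis
    by (subst (asm) has_bochner_integral_cong_AE) auto
qed

text \<open>The geometric mean is 1, so normalization changes nothing, and the atom
  \<open>z_root \<mu> v\<close> lies outside the tail, which therefore has exactly the mass at
  \<open>v\<close>.\<close>

lemma two_point_optimal:
  assumes v: "1 < \<mu>" "v \<in> {0<..<1} \<union> {\<mu><..}"
    and tp: "two_point N Y v (z_root \<mu> v) (p_bound \<mu> v)"
  shows "admissible N Y" "ratio N Y = \<mu>"
    "\<mu> < v \<Longrightarrow> right_tail N Y v = p_bound \<mu> v" "v < 1 \<Longrightarrow> left_tail N Y v = p_bound \<mu> v"
proof -
  interpret prob_space N by (rule two_pointD(1)[OF tp])
  have [measurable]: "Y \<in> borel_measurable N" by (rule two_pointD(2)[OF tp])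
  note z = z_root_props[OF v] and m = p_bound_moments[OF v]
  have vz: "v \<noteq> z_root \<mu> v" using z by simp
  have Y: "has_bochner_integral N Y \<mu>"
    using two_point_moment[OF tp vz, of "\<lambda>x. x"] m by simp
  have lnY: "has_bochner_integral N (\<lambda>\<omega>. ln (Y \<omega>)) 0"
    using two_point_moment[OF tp vz, of ln] m by simp
  show "admissible N Y"
    using tp Y lnY by (auto simp: admissible_def two_point_def has_bochner_integral_iff)
  have G: "geom_mean N Y = 1"
    using lnY by (simp add: geom_mean_def has_bochner_integral_iff)
  then show "ratio N Y = \<mu>"
    using Y by (simp add: ratio_def arith_mean_def has_bochner_integral_iff)
  show "right_tail N Y v = p_bound \<mu> v" if "\<mu> < v"
  proof -
    have "right_tail N Y v = measure N {\<omega> \<in> space N. Y \<omega> = v}"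
      unfolding right_tail_def G
    proof (rule finite_measure_eq_AE)
      show "AE \<omega> in N. \<omega> \<in> {\<omega> \<in> space N. v \<le> Y \<omega> / 1} \<longleftrightarrow> \<omega> \<in> {\<omega> \<in> space N. Y \<omega> = v}"
        using two_point_AE[OF tp vz] z_root_below_1[OF v(1) that] v(1) that
        by (auto elim!: eventually_mono)
    qed auto
    then show ?thesis using two_pointD(4)[OF tp] by simp
  qed
  show "left_tail N Y v = p_bound \<mu> v" if "v < 1"
  proof -
    have "left_tail N Y v = measure N {\<omega> \<in> space N. Y \<omega> = v}"
      unfolding left_tail_def G
    proof (rule finite_measure_eq_AE)
      show "AE \<omega> in N. \<omega> \<in> {\<omega> \<in> space N. Y \<omega> / 1 \<le> v} \<longleftrightarrow> \<omega> \<in> {\<omega> \<in> space N. Y \<omega> = v}"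
        using two_point_AE[OF tp vz] z_root_above[OF v(1) z(1) that] v(1) that
        by (auto elim!: eventually_mono)
    qed auto
    then show ?thesis using two_pointD(4)[OF tp] by simp
  qed
qed

lemma ex_two_point:
  assumes "0 < a" "0 < b" "a \<noteq> b" "0 \<le> p" "p \<le> 1"
  shows "\<exists>(N :: real measure) Y. two_point N Y a b p"
proof (intro exI)
  \<comment> \<open>A Bernoulli law carried to the points 0 and 1 of the reals, to match the type in
    the index sets; \<open>?Y\<close> is positive on the whole line, not just at these
    points.\<close>
  let ?N = "measure_pmf (map_pmf of_bool (bernoulli_pmf p)) :: real measure"
  let ?Y = "\<lambda>x::real. if x = 1 then a else b"
  have "of_bool -` {x. ?Y x = a} = {True}" "of_bool -` {x. ?Y x = b} = {False}"
    using assms by (auto simp: of_bool_def split: if_splits)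
  then have "measure ?N {x. ?Y x = a} = p" "measure ?N {x. ?Y x = b} = 1 - p"
    using assms by (simp_all only: measure_map_pmf) (simp_all add: measure_pmf_single)
  then show "two_point ?N ?Y a b p"
    using assms by (simp add: two_point_def pos_rv_def measure_pmf.prob_space_axioms)
qed

lemma ex_two_point_optimal:
  assumes v: "1 < \<mu>" "v \<in> {0<..<1} \<union> {\<mu><..}"
  shows "\<exists>(N :: real measure) Y. two_point N Y v (z_root \<mu> v) (p_bound \<mu> v)"
  using z_root_props[OF v] p_bound_in_unit[OF v] by (intro ex_two_point) auto

section \<open>Limits of \<open>p_bound\<close> and the suprema\<close>

lemma p_bound_near_1_right:
  assumes "1 < \<mu>" "e < 1"
  shows "\<exists>v>\<mu>. e < p_bound \<mu> v"
proof -
  \<comment> \<open>The offset makes \<open>(v - \<mu>) / (\<mu> - 1)\<close>, which bounds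
    \<open>1 - p_bound \<mu> v\<close> because \<open>z_root \<mu> v < 1\<close>, equal to
    \<open>(1 - e) / 2\<close>.\<close>
  define v where "v = \<mu> + (1 - e) * (\<mu> - 1) / 2"
  have v: "\<mu> < v" using assms by (simp add: v_def)
  note z = z_root_below_1[OF assms(1) v]
  have "1 - p_bound \<mu> v = (v - \<mu>) / (v - z_root \<mu> v)"
    using z v assms by (simp add: p_bound_def field_simps)
  also have "\<dots> \<le> (v - \<mu>) / (\<mu> - 1)"
    using z v assms by (intro divide_left_mono) auto
  also have "\<dots> = (1 - e) / 2" using assms by (simp add: v_def field_simps)
  also have "\<dots> < 1 - e" using assms by simp
  finally have "e < p_bound \<mu> v" by simp
  with v show ?thesis by blast
qed

text \<open>As \<open>v\<close> increases to 1 the root escapes to infinity, while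
  \<open>1 - p_bound \<mu> v\<close> is \<open>(\<mu> - v) / (z - v)\<close> with bounded
  numerator.\<close>

lemma p_bound_near_1_left:
  assumes "1 < \<mu>" "e < 1"
  shows "\<exists>v\<in>{0<..<1}. e < p_bound \<mu> v"
proof -
  define K where "K = (\<mu> - 1) * ln \<mu>"
  have K: "0 < K" using assms by (simp add: K_def)
  \<comment> \<open>\<open>K\<close> bounds \<open>(\<mu> - v) * ln z\<close> from below, and
    \<open>F_eq\<close> zero turns this into \<open>K \<le> (z - \<mu>) * \<delta>\<close>; \<delta>
    is chosen so that \<open>K / \<delta> = 2 * \<mu> / (1 - e)\<close>.\<close>
  define \<delta> where "\<delta> = (1 - e) * K / (2 * \<mu>)"
  define v where "v = exp (- \<delta>)"
  have \<delta>: "0 < \<delta>" using assms K by (simp add: \<delta>_def)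
  then have v: "0 < v" "v < 1" by (simp_all add: v_def)
  define z where "z = z_root \<mu> v"
  note z = z_root_above[OF assms(1) v, folded z_def]
  have p: "p_bound \<mu> v < 1" using p_bound_in_unit[of \<mu> v] assms v by auto
  have "K \<le> (\<mu> - v) * ln z"
    unfolding K_def using z v assms by (intro mult_mono) auto
  also have "\<dots> = (z - \<mu>) * \<delta>"
    using z(2) by (simp add: F_eq_def v_def algebra_simps)
  finally have "K * (2 * \<mu>) \<le> K * ((z - \<mu>) * (1 - e))"
    using assms by (simp add: \<delta>_def pos_le_divide_eq ac_simps)
  then have "2 * \<mu> / (1 - e) \<le> z - \<mu>"
    using assms K by (simp add: pos_divide_le_eq)
  also have "\<dots> \<le> z - v" using v assms by simp
  finally have "(1 - p_bound \<mu> v) * (2 * \<mu> / (1 - e)) \<le> (1 - p_bound \<mu> v) * (z - v)"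
    using p by (intro mult_left_mono) auto
  also have "\<dots> = \<mu> - v"
    using z v assms by (simp add: p_bound_def z_def[symmetric] field_simps)
  also have "\<dots> < 2 * \<mu>" using v assms by simp
  finally have "1 - p_bound \<mu> v < 1 - e" using assms by (simp add: field_simps)
  with v show ?thesis by auto
qed

lemma SUP_pair_eqI:
  fixes f :: "'a \<Rightarrow> 'b \<Rightarrow> real"
  assumes "\<And>x y. (x, y) \<in> S \<Longrightarrow> f x y \<le> b"
    and "\<And>e. e < b \<Longrightarrow> \<exists>x y. (x, y) \<in> S \<and> e < f x y"
  shows "(SUP (x, y)\<in>S. f x y) = b"
proof (rule cSup_eq)
  fix u assume u: "\<And>t. t \<in> (\<lambda>(x, y). f x y) ` S \<Longrightarrow> t \<le> u"
  show "b \<le> u"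
  proof (rule ccontr)
    assume "\<not> b \<le> u"
    then obtain x y where "(x, y) \<in> S" "u < f x y" using assms(2)[of u] by auto
    then show False using u[of "f x y"] by force
  qed
qed (use assms(1) in auto)

text \<open>The sandwiched \<open>S\<close> treats both index sets at once: the upper bounds need
  only ratio at most \<mu>, and the extremal laws have ratio exactly \<mu>.\<close>

lemma tail_SUP:
  assumes \<mu>: "1 < \<mu>" and S: "rvs_ratio_eq \<mu> \<subseteq> S" "S \<subseteq> rvs_ratio_le \<mu>"
  shows "\<mu> < v \<Longrightarrow> (SUP (N, Y)\<in>S. right_tail N Y v) = p_bound \<mu> v"
    and "0 < v \<Longrightarrow> v < 1 \<Longrightarrow> (SUP (N, Y)\<in>S. left_tail N Y v) = p_bound \<mu> v"
    and "v \<le> \<mu> \<Longrightarrow> (SUP (N, Y)\<in>S. right_tail N Y v) = 1"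
    and "1 \<le> v \<Longrightarrow> (SUP (N, Y)\<in>S. left_tail N Y v) = 1"
proof -
  have S_D: "admissible N Y" "ratio N Y \<le> \<mu>" if "(N, Y) \<in> S" for N Y
    using S(2) that by (auto simp: rvs_ratio_le_def)
  have right: "\<exists>N Y. (N, Y) \<in> S \<and> right_tail N Y w = p_bound \<mu> w" if "\<mu> < w" for w
    using ex_two_point_optimal[of \<mu> w] two_point_optimal[of \<mu> w] \<mu> S(1) that
    by (force simp: rvs_ratio_eq_def)
  have left: "\<exists>N Y. (N, Y) \<in> S \<and> left_tail N Y w = p_bound \<mu> w" if "0 < w" "w < 1" for w
    using ex_two_point_optimal[of \<mu> w] two_point_optimal[of \<mu> w] \<mu> S(1) that
    by (force simp: rvs_ratio_eq_def)
  show "(SUP (N, Y)\<in>S. right_tail N Y v) = p_bound \<mu> v" if "\<mu> < v"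
  proof (rule SUP_pair_eqI)
    show "right_tail N Y v \<le> p_bound \<mu> v" if "(N, Y) \<in> S" for N Y
      by (rule right_tail_le_p_bound) (use S_D[OF that] \<mu> \<open>\<mu> < v\<close> in auto)
  qed (use right[OF that] in force)
  show "(SUP (N, Y)\<in>S. left_tail N Y v) = p_bound \<mu> v" if "0 < v" "v < 1"
  proof (rule SUP_pair_eqI)
    show "left_tail N Y v \<le> p_bound \<mu> v" if "(N, Y) \<in> S" for N Y
      by (rule left_tail_le_p_bound) (use S_D[OF that] \<mu> \<open>0 < v\<close> \<open>v < 1\<close> in auto)
  qed (use left[OF that] in force)
  show "(SUP (N, Y)\<in>S. right_tail N Y v) = 1" if "v \<le> \<mu>"
  proof (rule SUP_pair_eqI)
    fix e :: real assume "e < 1"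
    \<comment> \<open>The tail at \<open>v\<close> contains the tail at \<open>w\<close>, whose
      largest probability is already close to 1.\<close>
    then obtain w where w: "\<mu> < w" "e < p_bound \<mu> w" using p_bound_near_1_right[OF \<mu>] by blast
    then obtain N Y where N: "(N, Y) \<in> S" "right_tail N Y w = p_bound \<mu> w" using right by blast
    interpret prob_space N using admissibleD(1)[OF S_D(1)] N by blast
    have "right_tail N Y w \<le> right_tail N Y v"
      unfolding right_tail_def using that w tail_measurable[OF S_D(1)[OF N(1)]]
      by (intro finite_measure_mono) auto
    then show "\<exists>N Y. (N, Y) \<in> S \<and> e < right_tail N Y v" using N w by force
  qed (use tail_le_1 S_D in blast)
  show "(SUP (N, Y)\<in>S. left_tail N Y v) = 1" if "1 \<le> v"
  proof (rule SUP_pair_eqI)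
    fix e :: real assume "e < 1"
    then obtain w where w: "0 < w" "w < 1" "e < p_bound \<mu> w" using p_bound_near_1_left[OF \<mu>] by force
    then obtain N Y where N: "(N, Y) \<in> S" "left_tail N Y w = p_bound \<mu> w" using left by blast
    interpret prob_space N using admissibleD(1)[OF S_D(1)] N by blast
    have "left_tail N Y w \<le> left_tail N Y v"
      unfolding left_tail_def using that w tail_measurable[OF S_D(1)[OF N(1)]]
      by (intro finite_measure_mono) auto
    then show "\<exists>N Y. (N, Y) \<in> S \<and> e < left_tail N Y v" using N w by force
  qed (use tail_le_1 S_D in blast)
qed

section \<open>The assertions for a prescribed and for a bounded ratio\<close>

theorem theorem2p1:
  fixes M :: "'a measure" and X :: "'a \<Rightarrow> real" and \<mu> :: real
  assumes adm: "admissible M X"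
    and nonconst: "nonconstant_rv M X"
    and mu: "\<mu> = arith_mean M X / geom_mean M X"
  shows "\<mu> > 1 \<and>
    \<comment> \<open>(I)\<close>
    (\<forall>v>\<mu>. (\<exists>!z. z \<in> {0<..<1} \<and> F_eq \<mu> v z = 0)
        \<and> right_tail M X v \<le> p_bound \<mu> v \<and> p_bound \<mu> v \<in> {0<..<1}) \<and>
    (\<forall>v\<in>{0<..<1}. (\<exists>!z. z \<in> {\<mu><..} \<and> F_eq \<mu> v z = 0)
        \<and> left_tail M X v \<le> p_bound \<mu> v \<and> p_bound \<mu> v \<in> {0<..<1}) \<and>
    \<comment> \<open>(II)\<close>
    (\<forall>v>\<mu>.
        (SUP (N, Y)\<in>rvs_ratio_eq \<mu>. right_tail N Y v) = p_bound \<mu> v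
      \<and> (\<exists>(N :: real measure) Y. two_point N Y v (z_root \<mu> v) (p_bound \<mu> v))
      \<and> (\<forall>(N :: 'b measure) Y. two_point N Y v (z_root \<mu> v) (p_bound \<mu> v) \<longrightarrow>
            admissible N Y \<and> ratio N Y = \<mu> \<and> right_tail N Y v = p_bound \<mu> v)) \<and>
    (\<forall>v\<in>{0<..<1}.
        (SUP (N, Y)\<in>rvs_ratio_eq \<mu>. left_tail N Y v) = p_bound \<mu> v
      \<and> (\<exists>(N :: real measure) Y. two_point N Y v (z_root \<mu> v) (p_bound \<mu> v))
      \<and> (\<forall>(N :: 'b measure) Y. two_point N Y v (z_root \<mu> v) (p_bound \<mu> v) \<longrightarrow>
            admissible N Y \<and> ratio N Y = \<mu> \<and> left_tail N Y v = p_bound \<mu> v)) \<and>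
    \<comment> \<open>(III)\<close>
    (\<forall>v\<le>\<mu>. (SUP (N, Y)\<in>rvs_ratio_eq \<mu>. right_tail N Y v) = 1) \<and>
    (\<forall>v\<ge>1. (SUP (N, Y)\<in>rvs_ratio_eq \<mu>. left_tail N Y v) = 1) \<and>
    (\<forall>v\<in>{1..\<mu>}.
        (SUP (N, Y)\<in>rvs_ratio_eq \<mu>. right_tail N Y v) = 1
      \<and> (SUP (N, Y)\<in>rvs_ratio_eq \<mu>. left_tail N Y v) = 1
      \<and> (\<forall>(N :: 'b measure) Y. admissible N Y \<and> ratio N Y = \<mu> \<longrightarrow>
            right_tail N Y v \<noteq> 1 \<and> left_tail N Y v \<noteq> 1)) \<and>
    \<comment> \<open>(IV)\<close>
    (\<forall>v\<ge>1. right_tail M X v \<le> q_bound \<mu> v) \<and>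
    (\<forall>v\<in>{0<..\<mu>}. left_tail M X v \<le> q_bound \<mu> v) \<and>
    (\<forall>v\<in>{0<..<1} \<union> {\<mu><..}. p_bound \<mu> v < q_bound \<mu> v) \<and>
    \<comment> \<open>(V): the same with the ratio of the two means at most a given number above 1\<close>
    (\<forall>\<nu>>1.
      \<comment> \<open>(I)\<close>
      (\<forall>v>\<nu>. (\<exists>!z. z \<in> {0<..<1} \<and> F_eq \<nu> v z = 0) \<and> p_bound \<nu> v \<in> {0<..<1}
         \<and> (\<forall>(N :: 'b measure) Y. admissible N Y \<and> ratio N Y \<le> \<nu> \<longrightarrow>
               right_tail N Y v \<le> p_bound \<nu> v)) \<and>
      (\<forall>v\<in>{0<..<1}. (\<exists>!z. z \<in> {\<nu><..} \<and> F_eq \<nu> v z = 0) \<and> p_bound \<nu> v \<in> {0<..<1}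
         \<and> (\<forall>(N :: 'b measure) Y. admissible N Y \<and> ratio N Y \<le> \<nu> \<longrightarrow>
               left_tail N Y v \<le> p_bound \<nu> v)) \<and>
      \<comment> \<open>(II)\<close>
      (\<forall>v>\<nu>.
          (SUP (N, Y)\<in>rvs_ratio_le \<nu>. right_tail N Y v) = p_bound \<nu> v
        \<and> (\<exists>(N :: real measure) Y. two_point N Y v (z_root \<nu> v) (p_bound \<nu> v))
        \<and> (\<forall>(N :: 'b measure) Y. two_point N Y v (z_root \<nu> v) (p_bound \<nu> v) \<longrightarrow>
              admissible N Y \<and> ratio N Y \<le> \<nu> \<and> right_tail N Y v = p_bound \<nu> v)) \<and>
      (\<forall>v\<in>{0<..<1}.
          (SUP (N, Y)\<in>rvs_ratio_le \<nu>. left_tail N Y v) = p_bound \<nu> v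
        \<and> (\<exists>(N :: real measure) Y. two_point N Y v (z_root \<nu> v) (p_bound \<nu> v))
        \<and> (\<forall>(N :: 'b measure) Y. two_point N Y v (z_root \<nu> v) (p_bound \<nu> v) \<longrightarrow>
              admissible N Y \<and> ratio N Y \<le> \<nu> \<and> left_tail N Y v = p_bound \<nu> v)) \<and>
      \<comment> \<open>(III); for v in (1,\<nu>] the left tail can be 1 when the ratio is below \<nu>\<close>
      (\<forall>v\<le>\<nu>. (SUP (N, Y)\<in>rvs_ratio_le \<nu>. right_tail N Y v) = 1) \<and>
      (\<forall>v\<ge>1. (SUP (N, Y)\<in>rvs_ratio_le \<nu>. left_tail N Y v) = 1) \<and>
      (\<forall>(N :: 'b measure) Y. admissible N Y \<and> nonconstant_rv N Y \<and> ratio N Y \<le> \<nu> \<longrightarrow>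
          (\<forall>v\<in>{1..\<nu>}. right_tail N Y v \<noteq> 1) \<and> left_tail N Y 1 \<noteq> 1) \<and>
      \<comment> \<open>(IV)\<close>
      (\<forall>(N :: 'b measure) Y. admissible N Y \<and> ratio N Y \<le> \<nu> \<longrightarrow>
          (\<forall>v\<ge>1. right_tail N Y v \<le> q_bound \<nu> v)
        \<and> (\<forall>v\<in>{0<..\<nu>}. left_tail N Y v \<le> q_bound \<nu> v)) \<and>
      (\<forall>v\<in>{0<..<1} \<union> {\<nu><..}. p_bound \<nu> v < q_bound \<nu> v))"
proof -
  have mu_ratio: "ratio M X = \<mu>" by (simp add: ratio_def mu)
  have \<mu>: "1 < \<mu>" using ratio_gt_1[OF adm nonconst] mu_ratio by simp
  have le: "ratio M X \<le> \<mu>" using mu_ratio by simp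
  have eq_le: "rvs_ratio_eq \<nu> \<subseteq> rvs_ratio_le \<nu>" for \<nu>
    by (auto simp: rvs_ratio_eq_def rvs_ratio_le_def)
  note sup_eq = tail_SUP[OF _ order.refl eq_le] and sup_le = tail_SUP[OF _ eq_le order.refl]
  have opt_le: "ratio N Y \<le> \<nu>"
    if "1 < \<nu>" "v \<in> {0<..<1} \<union> {\<nu><..}" "two_point N Y v (z_root \<nu> v) (p_bound \<nu> v)"
    for N :: "'b measure" and Y \<nu> v
    using two_point_optimal(2)[OF that] by simp
  have not_1_eq: "right_tail N Y v \<noteq> 1" "left_tail N Y v \<noteq> 1"
    if "admissible N Y" "ratio N Y = \<mu>" "v \<in> {1..\<mu>}" for N :: "'b measure" and Y v
    using right_tail_eq_1_imp(1)[of N Y v] left_tail_eq_1_imp(1)[of N Y v] that \<mu> by auto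
  \<comment> \<open>The left tail is taken at 1 because \<open>1 \<le> ratio N Y\<close> then
    supplies the hypothesis of \<open>left_tail_eq_1_imp\<close>.\<close>
  have not_1_le: "1 \<le> v \<Longrightarrow> right_tail N Y v \<noteq> 1" "left_tail N Y 1 \<noteq> 1"
    if "admissible N Y" "nonconstant_rv N Y" for N :: "'b measure" and Y v
    using right_tail_eq_1_imp(2)[of N Y v] left_tail_eq_1_imp(2)[of N Y 1] ratio_ge_1[of N Y] that
    by auto
  show ?thesis
    by (intro conjI ballI allI impI;
        (rule \<mu> ex1_root_below_1 ex1_root_above p_bound_in_unit p_bound_less_q_bound
           right_tail_le_p_bound left_tail_le_p_bound right_tail_le_q_bound left_tail_le_q_bound
           sup_eq sup_le ex_two_point_optimal two_point_optimal opt_le not_1_eq not_1_le;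
         use \<mu> adm le in \<open>simp; fail\<close>))
qed

end
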